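(* Let $M$ be a smooth even-dimensional manifold with a linear connection $\nabla$. Suppose $j$ is a self-holomorphic almost complex structure on $M$ and $g\cdot\nabla=\nabla$ for some diffeomorphism $g$ of $M$. Then the almost complex structure $\tilde j=dg\, j\, dg^{-1}$ is self-holomorphic.
   Context: A diffeomorphism $g$ of $M$ acts on vector fields by $(g\cdot X)_x=dg(X_{g^{-1}(x)})$ and on linear connections by $(g\cdot\nabla)_XY=g\cdot(\nabla_{g^{-1}\cdot X}\,g^{-1}\cdot Y)$ for all vector fields $X,Y$. The almost complex structure $\tilde j=dg\,j\,dg^{-1}$ is, at $y\in M$, $\tilde j_y=dg\circ j_{g^{-1}(y)}\circ (dg^{-1})_y$. An almost complex structure $j$ on $M$ is called self-holomorphic (with respect to $\nabla$) if it satisfies condition $A(j,j)$: for all complex vector fields $X,Y$ of type $(1,0)$ with respect to $j$ (sections of the $+i$-eigenbundle of $j$ in $TM\otimes\mathbb C$), $\nabla_XY$ is again of type $(1,0)$ with respect to $j$. *)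

theory Defs
  imports "HOL-Analysis.Analysis" "HOL-Library.Function_Algebras"
begin

text \<open>The carrier of \<open>\<real>\<^sup>n\<close> is \<open>topspace (Euclidean_space n)\<close>: functions \<open>nat \<Rightarrow> real\<close> that
  vanish from index \<open>n\<close> on. \<open>Ck k n U f\<close> is meant for \<open>U\<close> open in \<open>\<real>\<^sup>n\<close> and says that all partial
  derivatives of \<open>f\<close> of order at most \<open>k\<close> exist and are continuous on \<open>U\<close>.\<close>

primrec Ck :: "nat \<Rightarrow> nat \<Rightarrow> (nat \<Rightarrow> real) set \<Rightarrow> ((nat \<Rightarrow> real) \<Rightarrow> real) \<Rightarrow> bool" where
  "Ck 0 n U f \<longleftrightarrow> continuous_map (subtopology (Euclidean_space n) U) euclideanreal f"
| "Ck (Suc k) n U f \<longleftrightarrow>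
     continuous_map (subtopology (Euclidean_space n) U) euclideanreal f \<and>
     (\<forall>i<n. \<exists>f'. (\<forall>x\<in>U. ((\<lambda>t. f (x(i := t))) has_real_derivative f' x) (at (x i))) \<and> Ck k n U f')"

definition Cinf :: "nat \<Rightarrow> (nat \<Rightarrow> real) set \<Rightarrow> ((nat \<Rightarrow> real) \<Rightarrow> real) \<Rightarrow> bool" where
  "Cinf n U f \<longleftrightarrow> (\<forall>k. Ck k n U f)"

definition Cinf_map ::
  "nat \<Rightarrow> nat \<Rightarrow> (nat \<Rightarrow> real) set \<Rightarrow> ((nat \<Rightarrow> real) \<Rightarrow> (nat \<Rightarrow> real)) \<Rightarrow> bool" where
  "Cinf_map n m U F \<longleftrightarrow> (\<forall>i<m. Cinf n U (\<lambda>x. F x i))"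


type_synonym 'a chart = "'a set \<times> ('a \<Rightarrow> nat \<Rightarrow> real)"

record 'a manifold =
  mfd_top :: "'a topology"
  mfd_dim :: nat
  mfd_atlas :: "'a chart set"

abbreviation pts :: "'a manifold \<Rightarrow> 'a set" where
  "pts M \<equiv> topspace (mfd_top M)"

definition is_chart :: "'a manifold \<Rightarrow> 'a chart \<Rightarrow> bool" where
  "is_chart M = (\<lambda>(U, \<phi>).
     openin (mfd_top M) U \<and> openin (Euclidean_space (mfd_dim M)) (\<phi> ` U) \<and>
     homeomorphic_map (subtopology (mfd_top M) U)
       (subtopology (Euclidean_space (mfd_dim M)) (\<phi> ` U)) \<phi>)"

definition smooth_manifold :: "'a manifold \<Rightarrow> bool" where
  "smooth_manifold M \<longleftrightarrow>
     Hausdorff_space (mfd_top M) \<and> second_countable (mfd_top M) \<and>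
     (\<forall>c\<in>mfd_atlas M. is_chart M c) \<and>
     (\<Union>(U, \<phi>)\<in>mfd_atlas M. U) = pts M \<and>
     (\<forall>(U, \<phi>)\<in>mfd_atlas M. \<forall>(V, \<psi>)\<in>mfd_atlas M.
        Cinf_map (mfd_dim M) (mfd_dim M) (\<phi> ` (U \<inter> V)) (\<psi> \<circ> inv_into U \<phi>))"

text \<open>Membership depends only on the values on \<open>pts M\<close>.\<close>

definition smooth_functions :: "'a manifold \<Rightarrow> ('a \<Rightarrow> real) set" where
  "smooth_functions M =
     {f. \<forall>(U, \<phi>)\<in>mfd_atlas M. Cinf (mfd_dim M) (\<phi> ` U) (f \<circ> inv_into U \<phi>)}"

definition smooth_map :: "'a manifold \<Rightarrow> 'b manifold \<Rightarrow> ('a \<Rightarrow> 'b) \<Rightarrow> bool" where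
  "smooth_map M N g \<longleftrightarrow>
     continuous_map (mfd_top M) (mfd_top N) g \<and>
     (\<forall>(U, \<phi>)\<in>mfd_atlas M. \<forall>(V, \<psi>)\<in>mfd_atlas N.
        Cinf_map (mfd_dim M) (mfd_dim N) (\<phi> ` (U \<inter> g -` V)) (\<psi> \<circ> g \<circ> inv_into U \<phi>))"

abbreviation mfd_inv :: "'a manifold \<Rightarrow> ('a \<Rightarrow> 'a) \<Rightarrow> 'a \<Rightarrow> 'a" where
  "mfd_inv M g \<equiv> inv_into (pts M) g"

definition diffeo :: "'a manifold \<Rightarrow> ('a \<Rightarrow> 'a) \<Rightarrow> bool" where
  "diffeo M g \<longleftrightarrow>
     bij_betw g (pts M) (pts M) \<and> smooth_map M M g \<and> smooth_map M M (mfd_inv M g)"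


text \<open>Tangent vectors at \<open>p\<close> are derivations at \<open>p\<close> of the algebra of smooth functions, made
  extensional by the value \<open>0\<close> on non-smooth functions. The Leibniz rule forces
  \<open>v f = v h\<close> whenever \<open>f\<close> and \<open>h\<close> agree on \<open>pts M\<close>.\<close>

type_synonym 'a tvec = "('a \<Rightarrow> real) \<Rightarrow> real"

definition tangent_space :: "'a manifold \<Rightarrow> 'a \<Rightarrow> 'a tvec set" where
  "tangent_space M p =
     {v. (\<forall>f\<in>smooth_functions M. \<forall>h\<in>smooth_functions M. v (f + h) = v f + v h) \<and>
         (\<forall>c. \<forall>f\<in>smooth_functions M. v (\<lambda>x. c * f x) = c * v f) \<and>
         (\<forall>f\<in>smooth_functions M. \<forall>h\<in>smooth_functions M. v (f * h) = f p * v h + h p * v f) \<and>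
         (\<forall>f. f \<notin> smooth_functions M \<longrightarrow> v f = 0)}"

definition tscale :: "real \<Rightarrow> 'a tvec \<Rightarrow> 'a tvec" where
  "tscale c v = (\<lambda>f. c * v f)"

text \<open>Smooth vector fields, extended by the zero vector outside \<open>pts M\<close>.\<close>

definition vector_fields :: "'a manifold \<Rightarrow> ('a \<Rightarrow> 'a tvec) set" where
  "vector_fields M =
     {X. (\<forall>p\<in>pts M. X p \<in> tangent_space M p) \<and> (\<forall>p. p \<notin> pts M \<longrightarrow> X p = 0) \<and>
         (\<forall>f\<in>smooth_functions M. (\<lambda>p. X p f) \<in> smooth_functions M)}"

definition field_scale :: "'a manifold \<Rightarrow> ('a \<Rightarrow> real) \<Rightarrow> ('a \<Rightarrow> 'a tvec) \<Rightarrow> 'a \<Rightarrow> 'a tvec" where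
  "field_scale M f X = (\<lambda>p. if p \<in> pts M then tscale (f p) (X p) else 0)"

text \<open>The function \<open>X f\<close>.\<close>

definition lie_deriv :: "('a \<Rightarrow> 'a tvec) \<Rightarrow> ('a \<Rightarrow> real) \<Rightarrow> 'a \<Rightarrow> real" where
  "lie_deriv X f = (\<lambda>p. X p f)"


type_synonym 'a connection = "('a \<Rightarrow> 'a tvec) \<Rightarrow> ('a \<Rightarrow> 'a tvec) \<Rightarrow> 'a \<Rightarrow> 'a tvec"

definition linear_connection :: "'a manifold \<Rightarrow> 'a connection \<Rightarrow> bool" where
  "linear_connection M nabla \<longleftrightarrow>
     (\<forall>X\<in>vector_fields M. \<forall>Y\<in>vector_fields M. nabla X Y \<in> vector_fields M) \<and>
     (\<forall>X\<in>vector_fields M. \<forall>X'\<in>vector_fields M. \<forall>Y\<in>vector_fields M.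
        nabla (X + X') Y = nabla X Y + nabla X' Y) \<and>
     (\<forall>f\<in>smooth_functions M. \<forall>X\<in>vector_fields M. \<forall>Y\<in>vector_fields M.
        nabla (field_scale M f X) Y = field_scale M f (nabla X Y)) \<and>
     (\<forall>X\<in>vector_fields M. \<forall>Y\<in>vector_fields M. \<forall>Y'\<in>vector_fields M.
        nabla X (Y + Y') = nabla X Y + nabla X Y') \<and>
     (\<forall>f\<in>smooth_functions M. \<forall>X\<in>vector_fields M. \<forall>Y\<in>vector_fields M.
        nabla X (field_scale M f Y) =
          field_scale M (lie_deriv X f) Y + field_scale M f (nabla X Y))"


text \<open>The differential of a smooth \<open>g\<close> from \<open>M\<close> to \<open>M\<close>; on derivations its formula does not
  mention the base point: \<open>v\<close> at \<open>p\<close> is sent to \<open>f \<mapsto> v (f \<circ> g)\<close> at \<open>g p\<close>.\<close>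

definition differential :: "'a manifold \<Rightarrow> ('a \<Rightarrow> 'a) \<Rightarrow> 'a tvec \<Rightarrow> 'a tvec" where
  "differential M g v = (\<lambda>f. if f \<in> smooth_functions M then v (f \<circ> g) else 0)"

definition act_field :: "'a manifold \<Rightarrow> ('a \<Rightarrow> 'a) \<Rightarrow> ('a \<Rightarrow> 'a tvec) \<Rightarrow> 'a \<Rightarrow> 'a tvec" where
  "act_field M g X = (\<lambda>x. if x \<in> pts M then differential M g (X (mfd_inv M g x)) else 0)"

definition act_connection :: "'a manifold \<Rightarrow> ('a \<Rightarrow> 'a) \<Rightarrow> 'a connection \<Rightarrow> 'a connection" where
  "act_connection M g nabla X Y =
     act_field M g (nabla (act_field M (mfd_inv M g) X) (act_field M (mfd_inv M g) Y))"


text \<open>A bundle endomorphism \<open>j\<close> is a family \<open>j p\<close>; only its values on tangent vectors at points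
  of \<open>M\<close> matter. Smoothness: it maps smooth vector fields to smooth vector fields.\<close>

definition almost_complex_structure ::
  "'a manifold \<Rightarrow> ('a \<Rightarrow> 'a tvec \<Rightarrow> 'a tvec) \<Rightarrow> bool" where
  "almost_complex_structure M j \<longleftrightarrow>
     (\<forall>p\<in>pts M.
        (\<forall>v\<in>tangent_space M p. j p v \<in> tangent_space M p) \<and>
        (\<forall>v\<in>tangent_space M p. \<forall>w\<in>tangent_space M p. j p (v + w) = j p v + j p w) \<and>
        (\<forall>c. \<forall>v\<in>tangent_space M p. j p (tscale c v) = tscale c (j p v)) \<and>
        (\<forall>v\<in>tangent_space M p. j p (j p v) = - v)) \<and>
     (\<forall>X\<in>vector_fields M. (\<lambda>p. if p \<in> pts M then j p (X p) else 0) \<in> vector_fields M)"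

definition conj_endo ::
  "'a manifold \<Rightarrow> ('a \<Rightarrow> 'a) \<Rightarrow> ('a \<Rightarrow> 'a tvec \<Rightarrow> 'a tvec) \<Rightarrow> 'a \<Rightarrow> 'a tvec \<Rightarrow> 'a tvec" where
  "conj_endo M g j y =
     differential M g \<circ> j (mfd_inv M g y) \<circ> differential M (mfd_inv M g)"


text \<open>The complexified tangent space \<open>T\<^sub>pM \<otimes> \<complex>\<close> consists of pairs: \<open>(u, v)\<close> stands for \<open>u + i v\<close>.\<close>

type_synonym 'a ctvec = "'a tvec \<times> 'a tvec"

definition mult_i :: "'a ctvec \<Rightarrow> 'a ctvec" where
  "mult_i = (\<lambda>(u, v). (- v, u))"

definition complexify :: "('a tvec \<Rightarrow> 'a tvec) \<Rightarrow> 'a ctvec \<Rightarrow> 'a ctvec" where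
  "complexify J = (\<lambda>(u, v). (J u, J v))"

definition re_part :: "('a \<Rightarrow> 'a ctvec) \<Rightarrow> 'a \<Rightarrow> 'a tvec" where
  "re_part Z = (\<lambda>p. fst (Z p))"

definition im_part :: "('a \<Rightarrow> 'a ctvec) \<Rightarrow> 'a \<Rightarrow> 'a tvec" where
  "im_part Z = (\<lambda>p. snd (Z p))"

definition complex_vector_fields :: "'a manifold \<Rightarrow> ('a \<Rightarrow> 'a ctvec) set" where
  "complex_vector_fields M = {Z. re_part Z \<in> vector_fields M \<and> im_part Z \<in> vector_fields M}"

text \<open>Complex bilinear extension of a connection to complex vector fields.\<close>

definition complex_connection ::
  "'a connection \<Rightarrow> ('a \<Rightarrow> 'a ctvec) \<Rightarrow> ('a \<Rightarrow> 'a ctvec) \<Rightarrow> 'a \<Rightarrow> 'a ctvec" where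
  "complex_connection nabla Z W =
     (\<lambda>p. (nabla (re_part Z) (re_part W) p - nabla (im_part Z) (im_part W) p,
           nabla (re_part Z) (im_part W) p + nabla (im_part Z) (re_part W) p))"

definition fields_10 ::
  "'a manifold \<Rightarrow> ('a \<Rightarrow> 'a tvec \<Rightarrow> 'a tvec) \<Rightarrow> ('a \<Rightarrow> 'a ctvec) set" where
  "fields_10 M j =
     {Z \<in> complex_vector_fields M. \<forall>p\<in>pts M. complexify (j p) (Z p) = mult_i (Z p)}"

definition self_holomorphic ::
  "'a manifold \<Rightarrow> 'a connection \<Rightarrow> ('a \<Rightarrow> 'a tvec \<Rightarrow> 'a tvec) \<Rightarrow> bool" where
  "self_holomorphic M nabla j \<longleftrightarrow>
     almost_complex_structure M j \<and>
     (\<forall>X\<in>fields_10 M j. \<forall>Y\<in>fields_10 M j. complex_connection nabla X Y \<in> fields_10 M j)"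

end

theory Submission
  imports Defs
begin

text \<open>The conclusion is the hypothesis on \<open>j\<close> carried along \<open>g\<close>. A complex field \<open>Z\<close> is of type
  \<open>(1,0)\<close> for \<open>dg j dg\<inverse>\<close> iff \<open>g\<inverse>\<cdot>Z\<close> is of type \<open>(1,0)\<close> for \<open>j\<close>, and
  \<open>\<nabla>\<^sub>Z W = (g\<cdot>\<nabla>)\<^sub>Z W = g\<cdot>(\<nabla> (g\<inverse>\<cdot>Z) (g\<inverse>\<cdot>W))\<close> extends from real to complex fields by bilinearity.
  If \<open>Z\<close> and \<open>W\<close> are of type \<open>(1,0)\<close> for \<open>dg j dg\<inverse>\<close>, pulling back, differentiating and
  pushing forward therefore gives a field of type \<open>(1,0)\<close> again. Pullback and push-forward
  respect the type by \<open>act_complex_field_inverse_fields_10\<close> and \<open>act_complex_field_fields_10\<close>;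
  the resulting field is \<open>\<nabla>\<^sub>Z W\<close> by \<open>complex_connection_invariant\<close>.

  Two facts make the calculus of \<open>dg\<close> on derivations legitimate. First, \<open>dg\<close> sends \<open>v\<close> to
  \<open>f \<mapsto> v (f \<circ> g)\<close>, so \<open>f \<circ> g\<close> has to be smooth when \<open>f\<close> is (\<open>smooth_map_pullback\<close>). Smoothness is
  defined by iterated partial derivatives, so this rests on a chain rule for functions with
  continuous partial derivatives, on closure of the class under sums and products, and on its
  local nature, as composites are only controlled chart by chart. Second, \<open>dg\<close> and \<open>dg\<inverse>\<close>
  are inverse to each other although \<open>g \<circ> g\<inverse>\<close> is the identity only on the points of the
  manifold; this holds because a derivation does not see the values of a function elsewhere
  (\<open>tangent_vector_cong\<close>).\<close>

section \<open>Calculus of functions with continuous partial derivatives\<close>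

text \<open>Boxes rather than balls are used because the mean value theorem will be applied along one
  coordinate at a time: changing a coordinate within its bound stays in the box.\<close>

lemma Euclidean_space_open_box:
  assumes "openin (Euclidean_space n) W" "y \<in> W"
  obtains d where "d > 0"
    "\<And>z. \<lbrakk>\<And>i. i < n \<Longrightarrow> \<bar>z i - y i\<bar> < d; \<And>i. i \<ge> n \<Longrightarrow> z i = 0\<rbrakk> \<Longrightarrow> z \<in> W"
proof -
  obtain S where S: "openin (powertop_real UNIV) S" "W = S \<inter> {x. \<forall>i\<ge>n. x i = 0}"
    using assms(1) unfolding Euclidean_space_def openin_subtopology by auto
  with assms(2) obtain X where X: "y \<in> (\<Pi>\<^sub>E i\<in>UNIV. X i)" "\<And>i. open (X i)" "(\<Pi>\<^sub>E i\<in>UNIV. X i) \<subseteq> S"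
    using product_topology_open_contains_basis[OF S(1), of y] by auto
  have "\<forall>i. \<exists>e>0. \<forall>s. \<bar>s - y i\<bar> < e \<longrightarrow> s \<in> X i"
  proof
    fix i
    have "y i \<in> X i" using X(1) by auto
    with X(2)[of i] show "\<exists>e>0. \<forall>s. \<bar>s - y i\<bar> < e \<longrightarrow> s \<in> X i"
      unfolding open_dist by (metis dist_real_def)
  qed
  then obtain e where e: "\<And>i. e i > 0" "\<And>i s. \<bar>s - y i\<bar> < e i \<Longrightarrow> s \<in> X i"
    by metis
  \<comment> \<open>The extra 1 keeps the set nonempty in dimension 0.\<close>
  define d where "d = Min (insert 1 (e ` {..<n}))"
  show thesis
  proof
    show "d > 0" unfolding d_def using e(1) by auto
  next
    fix z assume z: "\<And>i. i < n \<Longrightarrow> \<bar>z i - y i\<bar> < d" "\<And>i. i \<ge> n \<Longrightarrow> z i = 0"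
    have "z i \<in> X i" for i
    proof (cases "i < n")
      case True
      then have "d \<le> e i" unfolding d_def by (intro Min_le) auto
      with z(1)[OF True] show ?thesis by (intro e(2)) simp
    next
      case False
      then have "z i = y i" using z(2) S(2) assms(2) by auto
      with X(1) show ?thesis by auto
    qed
    then show "z \<in> W" using X(3) z(2) S(2) by auto
  qed
qed

lemma eventually_coordinate_line_in_open:
  assumes "openin (Euclidean_space n) U" "x \<in> U" "i < n"
  shows "\<forall>\<^sub>F t in nhds (x i). x(i := t) \<in> U"
proof -
  obtain d where d: "d > 0"
    "\<And>z. \<lbrakk>\<And>i. i < n \<Longrightarrow> \<bar>z i - x i\<bar> < d; \<And>i. i \<ge> n \<Longrightarrow> z i = 0\<rbrakk> \<Longrightarrow> z \<in> U"
    using Euclidean_space_open_box[OF assms(1,2)] by metis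
  have x0: "x i = 0" if "i \<ge> n" for i
    using openin_subset[OF assms(1)] assms(2) that by (auto simp: topspace_Euclidean_space)
  have "x(i := t) \<in> U" if "dist t (x i) < d" for t
    by (rule d(2)) (use that d(1) x0 assms(3) in \<open>auto simp: dist_real_def\<close>)
  with d(1) show ?thesis unfolding eventually_nhds_metric by blast
qed

lemma Ck_imp_continuous_map:
  "Ck k n U f \<Longrightarrow> continuous_map (subtopology (Euclidean_space n) U) euclideanreal f"
  by (cases k) auto

lemma Ck_SucD:
  assumes "Ck (Suc k) n U f" "i < n"
  shows "\<exists>f'. (\<forall>x\<in>U. ((\<lambda>t. f (x(i := t))) has_real_derivative f' x) (at (x i))) \<and> Ck k n U f'"
  using assms by simp

lemma Ck_SucI:
  assumes "continuous_map (subtopology (Euclidean_space n) U) euclideanreal f"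
    "\<And>i. i < n \<Longrightarrow> \<exists>f'. (\<forall>x\<in>U. ((\<lambda>t. f (x(i := t))) has_real_derivative f' x) (at (x i))) \<and> Ck k n U f'"
  shows "Ck (Suc k) n U f"
  using assms by simp

lemma Ck_Suc_imp_Ck: "Ck (Suc k) n U f \<Longrightarrow> Ck k n U f"
proof (induction k arbitrary: f)
  case (Suc k)
  show ?case
  proof (rule Ck_SucI[OF Ck_imp_continuous_map[OF Suc.prems]])
    fix i assume "i < n"
    from Ck_SucD[OF Suc.prems this] Suc.IH
    show "\<exists>f'. (\<forall>x\<in>U. ((\<lambda>t. f (x(i := t))) has_real_derivative f' x) (at (x i))) \<and> Ck k n U f'"
      by metis
  qed
qed simp

text \<open>On an open set the coordinate line through a point stays in the set for a while, so the
  derivatives in the definition depend only on the values on that set.\<close>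

lemma Ck_cong:
  assumes "openin (Euclidean_space n) U" "\<And>x. x \<in> U \<Longrightarrow> f x = h x" "Ck k n U f"
  shows "Ck k n U h"
proof -
  have cont: "continuous_map (subtopology (Euclidean_space n) U) euclideanreal h"
    by (rule continuous_map_eq[OF Ck_imp_continuous_map[OF assms(3)]]) (use assms(2) in auto)
  show ?thesis
  proof (cases k)
    case (Suc m)
    show ?thesis unfolding Suc
    proof (rule Ck_SucI[OF cont])
      fix i assume i: "i < n"
      obtain f' where f': "\<And>x. x \<in> U \<Longrightarrow> ((\<lambda>t. f (x(i := t))) has_real_derivative f' x) (at (x i))"
        and C: "Ck m n U f'"
        using Ck_SucD assms(3) i Suc by blast
      have "((\<lambda>t. h (x(i := t))) has_real_derivative f' x) (at (x i))" if x: "x \<in> U" for x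
      proof -
        have "\<forall>\<^sub>F t in nhds (x i). f (x(i := t)) = h (x(i := t))"
          using eventually_coordinate_line_in_open[OF assms(1) x i]
          by eventually_elim (use assms(2) in auto)
        from DERIV_cong_ev[OF refl this refl] f' x show ?thesis by blast
      qed
      with C show "\<exists>f'. (\<forall>x\<in>U. ((\<lambda>t. h (x(i := t))) has_real_derivative f' x) (at (x i))) \<and> Ck m n U f'"
        by blast
    qed
  qed (use cont in simp)
qed

lemma continuous_map_on_open_locally:
  assumes "\<And>x. x \<in> U \<Longrightarrow> \<exists>V. openin X V \<and> x \<in> V \<and> V \<subseteq> U \<and> continuous_map (subtopology X V) Y f"
  shows "continuous_map (subtopology X U) Y f"
proof -
  define VV where "VV = {V. openin X V \<and> V \<subseteq> U \<and> continuous_map (subtopology X V) Y f}"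
  have U: "U = \<Union>VV" using assms unfolding VV_def by blast
  show ?thesis
  proof (rule pasting_lemma[where I = VV and T = "\<lambda>V. V" and f = "\<lambda>_. f"])
    fix V assume V: "V \<in> VV"
    then have "V \<subseteq> U" unfolding VV_def by blast
    then show "openin (subtopology X U) V"
      using V openin_subtopology_Int2 unfolding VV_def by (metis (no_types, lifting) inf.absorb_iff2 mem_Collect_eq)
    have "subtopology (subtopology X U) V = subtopology X V"
      using \<open>V \<subseteq> U\<close> by (simp add: subtopology_subtopology Int_absorb1)
    then show "continuous_map (subtopology (subtopology X U) V) Y f"
      using V unfolding VV_def by simp
  qed (use U in auto)
qed

text \<open>The local derivatives fit together because each of them is the actual partial derivative,
  which can be named globally by \<open>deriv\<close>.\<close>

lemma Ck_locally:
  assumes "\<And>x. x \<in> U \<Longrightarrow> \<exists>V. openin (Euclidean_space n) V \<and> x \<in> V \<and> V \<subseteq> U \<and> Ck k n V f"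
  shows "Ck k n U f"
  using assms
proof (induction k arbitrary: f)
  case 0
  then show ?case by (simp add: continuous_map_on_open_locally)
next
  case (Suc k)
  show ?case
  proof (rule Ck_SucI)
    show "continuous_map (subtopology (Euclidean_space n) U) euclideanreal f"
    proof (rule continuous_map_on_open_locally)
      fix x assume "x \<in> U"
      then obtain V where V: "openin (Euclidean_space n) V" "x \<in> V" "V \<subseteq> U" "Ck (Suc k) n V f"
        using Suc.prems by meson
      from V(1-3) Ck_imp_continuous_map[OF V(4)]
      show "\<exists>V. openin (Euclidean_space n) V \<and> x \<in> V \<and> V \<subseteq> U \<and>
          continuous_map (subtopology (Euclidean_space n) V) euclideanreal f"
        by (intro exI[of _ V] conjI)
    qed
  next
    fix i assume i: "i < n"
    define f' where "f' x = deriv (\<lambda>t. f (x(i := t))) (x i)" for x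
    have *: "\<exists>V. openin (Euclidean_space n) V \<and> x \<in> V \<and> V \<subseteq> U \<and> Ck k n V f' \<and>
        ((\<lambda>t. f (x(i := t))) has_real_derivative f' x) (at (x i))" if "x \<in> U" for x
    proof -
      obtain V where V: "openin (Euclidean_space n) V" "x \<in> V" "V \<subseteq> U" "Ck (Suc k) n V f"
        using Suc.prems[OF \<open>x \<in> U\<close>] by blast
      obtain e where e: "\<And>x. x \<in> V \<Longrightarrow> ((\<lambda>t. f (x(i := t))) has_real_derivative e x) (at (x i))"
        "Ck k n V e"
        using Ck_SucD[OF V(4) i] by blast
      have ef: "e x = f' x" if "x \<in> V" for x
        using DERIV_imp_deriv[OF e(1)[OF that]] unfolding f'_def by simp
      have "Ck k n V f'"
        by (rule Ck_cong[OF V(1) ef e(2)])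
      with V ef e(1) show ?thesis by metis
    qed
    have "Ck k n U f'"
      by (rule Suc.IH) (use * in blast)
    with * show "\<exists>f'. (\<forall>x\<in>U. ((\<lambda>t. f (x(i := t))) has_real_derivative f' x) (at (x i))) \<and> Ck k n U f'"
      by blast
  qed
qed

lemma Ck_const: "Ck k n U (\<lambda>x. c)"
proof (induction k arbitrary: c)
  case (Suc k)
  show ?case using Suc[of 0] by (auto intro!: exI[of _ "\<lambda>x. 0"])
qed auto

lemma Ck_add:
  "Ck k n U f \<Longrightarrow> Ck k n U h \<Longrightarrow> Ck k n U (\<lambda>x. f x + h x)"
proof (induction k arbitrary: f h)
  case 0
  then show ?case by (auto intro: continuous_map_add)
next
  case (Suc k)
  have "continuous_map (subtopology (Euclidean_space n) U) euclideanreal (\<lambda>x. f x + h x)"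
    using Suc.prems by (auto intro: continuous_map_add)
  moreover have "\<exists>e. (\<forall>x\<in>U. ((\<lambda>t. f (x(i := t)) + h (x(i := t))) has_real_derivative e x) (at (x i)))
      \<and> Ck k n U e" if i: "i < n" for i
  proof -
    obtain f' where f': "\<And>x. x\<in>U \<Longrightarrow> ((\<lambda>t. f (x(i := t))) has_real_derivative f' x) (at (x i))" "Ck k n U f'"
      using Ck_SucD[OF Suc.prems(1) i] by blast
    obtain h' where h': "\<And>x. x\<in>U \<Longrightarrow> ((\<lambda>t. h (x(i := t))) has_real_derivative h' x) (at (x i))" "Ck k n U h'"
      using Ck_SucD[OF Suc.prems(2) i] by blast
    show ?thesis
      using Suc.IH[OF f'(2) h'(2)]
      by (intro exI[of _ "\<lambda>x. f' x + h' x"] conjI ballI DERIV_add f'(1) h'(1))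
  qed
  ultimately show ?case by simp
qed

lemma Ck_mult:
  "Ck k n U f \<Longrightarrow> Ck k n U h \<Longrightarrow> Ck k n U (\<lambda>x. f x * h x)"
proof (induction k arbitrary: f h)
  case 0
  then show ?case by (auto intro: continuous_map_real_mult)
next
  case (Suc k)
  have "continuous_map (subtopology (Euclidean_space n) U) euclideanreal (\<lambda>x. f x * h x)"
    using Suc.prems by (auto intro: continuous_map_real_mult)
  moreover have "\<exists>e. (\<forall>x\<in>U. ((\<lambda>t. f (x(i := t)) * h (x(i := t))) has_real_derivative e x) (at (x i)))
      \<and> Ck k n U e" if i: "i < n" for i
  proof -
    obtain f' where f': "\<And>x. x\<in>U \<Longrightarrow> ((\<lambda>t. f (x(i := t))) has_real_derivative f' x) (at (x i))" "Ck k n U f'"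
      using Ck_SucD[OF Suc.prems(1) i] by blast
    obtain h' where h': "\<And>x. x\<in>U \<Longrightarrow> ((\<lambda>t. h (x(i := t))) has_real_derivative h' x) (at (x i))" "Ck k n U h'"
      using Ck_SucD[OF Suc.prems(2) i] by blast
    have "((\<lambda>t. f (x(i := t)) * h (x(i := t))) has_real_derivative f' x * h x + h' x * f x) (at (x i))"
      if "x \<in> U" for x
      using DERIV_mult[OF f'(1)[OF that] h'(1)[OF that]] by simp
    moreover have "Ck k n U (\<lambda>x. f' x * h x + h' x * f x)"
      by (rule Ck_add[OF Suc.IH[OF f'(2) Ck_Suc_imp_Ck[OF Suc.prems(2)]]
            Suc.IH[OF h'(2) Ck_Suc_imp_Ck[OF Suc.prems(1)]]])
    ultimately show ?thesis by (intro exI[of _ "\<lambda>x. f' x * h x + h' x * f x"]) simp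
  qed
  ultimately show ?case by simp
qed

lemma Ck_sum:
  "(\<And>j. j \<in> A \<Longrightarrow> Ck k n U (f j)) \<Longrightarrow> Ck k n U (\<lambda>x. \<Sum>j\<in>A. f j x)"
proof (induction A rule: infinite_finite_induct)
  case (insert a A)
  then show ?case using Ck_add[of k n U "f a" "\<lambda>x. \<Sum>j\<in>A. f j x"] by simp
qed (simp_all add: Ck_const)

text \<open>One summand of the chain rule. Let \<open>h\<^sub>j t\<close> be \<open>y\<close> with its first \<open>j\<close> coordinates
  replaced by those of the curve. The mean value theorem writes the increment from \<open>h\<^sub>j t\<close> to
  \<open>h\<^bsub>j+1\<^esub> t\<close> as \<open>a t * (c\<^sub>j t - y\<^sub>j)\<close>, where \<open>a t\<close> is a value of the partial derivative \<open>f'\<close>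
  at a point that tends to \<open>y\<close>. Continuity of \<open>f'\<close> thus makes \<open>a\<close> continuous, and
  Caratheodory's form of differentiability gives the derivative of the product.\<close>

lemma chain_rule_coordinate_increment:
  assumes W: "openin (Euclidean_space m) W" "y \<in> W"
    and df: "\<And>x. x \<in> W \<Longrightarrow> ((\<lambda>t. f (x(j := t))) has_real_derivative f' x) (at (x j))"
    and cf: "continuous_map (subtopology (Euclidean_space m) W) euclideanreal f'"
    and j: "j < m"
    and c: "\<And>i. i < m \<Longrightarrow> (c i has_real_derivative d i) (at t0)" "\<And>i. i < m \<Longrightarrow> c i t0 = y i"
  shows "((\<lambda>t. f (\<lambda>i. if i < Suc j then c i t else y i) - f (\<lambda>i. if i < j then c i t else y i))
            has_real_derivative f' y * d j) (at t0)"
proof -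
  define h where "h j t = (\<lambda>i. if i < j then c i t else y i)" for j t
  \<comment> \<open>The value at coinciding coordinates is the limit of the difference quotients.\<close>
  define a where "a t = (if c j t = y j then f' y else (f (h (Suc j) t) - f (h j t)) / (c j t - y j))" for t
  have h_Suc: "h (Suc j) t = (h j t)(j := c j t)" and h_upd: "h j t = (h j t)(j := y j)" for t
    unfolding h_def by (auto simp: less_Suc_eq)
  have incr: "f (h (Suc j) t) - f (h j t) = a t * (c j t - y j)" for t
    unfolding a_def using h_Suc[of t] h_upd[of t] by auto
  have y0: "y i = 0" if "i \<ge> m" for i
    using openin_subset[OF W(1)] W(2) that by (auto simp: topspace_Euclidean_space)
  have a_lim: "isCont a t0"
    unfolding isCont_def tendsto_iff
  proof (intro allI impI)
    fix e :: real assume "e > 0"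
    define W' where "W' = {x \<in> W. \<bar>f' x - f' y\<bar> < e}"
    have "openin (subtopology (Euclidean_space m) W) {x \<in> topspace (subtopology (Euclidean_space m) W). f' x \<in> ball (f' y) e}"
      by (rule openin_continuous_map_preimage[OF cf]) auto
    moreover have "{x \<in> topspace (subtopology (Euclidean_space m) W). f' x \<in> ball (f' y) e} = W'"
      using openin_subset[OF W(1)] unfolding W'_def by (auto simp: dist_real_def abs_minus_commute)
    ultimately have "openin (Euclidean_space m) W'"
      using openin_trans_full W(1) by metis
    moreover have "y \<in> W'" using W(2) \<open>e > 0\<close> unfolding W'_def by simp
    ultimately obtain r where r: "r > 0"
      "\<And>z. \<lbrakk>\<And>i. i < m \<Longrightarrow> \<bar>z i - y i\<bar> < r; \<And>i. i \<ge> m \<Longrightarrow> z i = 0\<rbrakk> \<Longrightarrow> z \<in> W'"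
      using Euclidean_space_open_box by metis
    have "\<forall>\<^sub>F t in at t0. \<forall>i\<in>{..<m}. dist (c i t) (y i) < r"
    proof (rule eventually_ball_finite)
      show "\<forall>i\<in>{..<m}. \<forall>\<^sub>F t in at t0. dist (c i t) (y i) < r"
      proof
        fix i assume "i \<in> {..<m}"
        then have "isCont (c i) t0" "c i t0 = y i" using DERIV_isCont[OF c(1)] c(2) by auto
        then show "\<forall>\<^sub>F t in at t0. dist (c i t) (y i) < r"
          unfolding isCont_def using tendstoD r(1) by metis
      qed
    qed auto
    then show "\<forall>\<^sub>F t in at t0. dist (a t) (a t0) < e"
    proof eventually_elim
      case (elim t)
      have at0: "a t0 = f' y" unfolding a_def using c(2) j by simp
      have in_box: "(h j t)(j := s) \<in> W'" if "\<bar>s - y j\<bar> < r" for s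
        by (rule r(2)) (use that elim r(1) y0 j in \<open>auto simp: h_def dist_real_def\<close>)
      define \<phi> where "\<phi> s = f ((h j t)(j := s))" for s
      have der: "(\<phi> has_real_derivative f' ((h j t)(j := s))) (at s)" if "\<bar>s - y j\<bar> < r" for s
        using df[of "(h j t)(j := s)"] in_box[OF that] unfolding \<phi>_def W'_def by simp
      have cr: "\<bar>c j t - y j\<bar> < r" using elim j by (auto simp: dist_real_def)
      show ?case
      proof (cases "c j t = y j")
        case True
        then show ?thesis using at0 \<open>e > 0\<close> by (simp add: a_def)
      next
        case False
        have "\<exists>s. \<bar>s - y j\<bar> < r \<and> \<phi> (c j t) - \<phi> (y j) = (c j t - y j) * f' ((h j t)(j := s))"
        proof (cases "y j < c j t")
          case True
          obtain s where "y j < s" "s < c j t" "\<phi> (c j t) - \<phi> (y j) = (c j t - y j) * f' ((h j t)(j := s))"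
            using MVT2[OF True, of \<phi> "\<lambda>s. f' ((h j t)(j := s))"] der cr by force
          then show ?thesis using cr by (intro exI[of _ s]) auto
        next
          case F: False
          then have lt: "c j t < y j" using False by auto
          obtain s where "s < y j" "c j t < s" "\<phi> (y j) - \<phi> (c j t) = (y j - c j t) * f' ((h j t)(j := s))"
            using MVT2[OF lt, of \<phi> "\<lambda>s. f' ((h j t)(j := s))"] der cr by force
          then show ?thesis using cr by (intro exI[of _ s]) (auto simp: algebra_simps)
        qed
        then obtain s where s: "\<bar>s - y j\<bar> < r"
          "\<phi> (c j t) - \<phi> (y j) = (c j t - y j) * f' ((h j t)(j := s))" by blast
        have "a t = f' ((h j t)(j := s))"
          using s(2) False h_Suc[of t] h_upd[of t] unfolding a_def \<phi>_def by simp
        with in_box[OF s(1)] at0 show ?thesis unfolding W'_def by (simp add: dist_real_def)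
      qed
    qed
  qed
  obtain q where q: "\<And>z. c j z - c j t0 = q z * (z - t0)" "isCont q t0" "q t0 = d j"
    using c(1)[OF j] unfolding CARAT_DERIV by blast
  have "((\<lambda>t. f (h (Suc j) t) - f (h j t)) has_real_derivative f' y * d j) (at t0)"
    unfolding CARAT_DERIV
  proof (intro exI[of _ "\<lambda>t. a t * q t"] conjI allI)
    fix z
    have "c j z - y j = q z * (z - t0)" "c j t0 = y j" using q(1)[of z] c(2)[OF j] by simp_all
    then show "f (h (Suc j) z) - f (h j z) - (f (h (Suc j) t0) - f (h j t0)) = a z * q z * (z - t0)"
      by (simp add: incr)
  next
    show "isCont (\<lambda>t. a t * q t) t0" using a_lim q(2) by simp
    show "a t0 * q t0 = f' y * d j" using q(3) c(2)[OF j] unfolding a_def by simp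
  qed
  then show ?thesis unfolding h_def .
qed

text \<open>Continuous partial derivatives suffice for the chain rule along a curve: the coordinates
  of \<open>y\<close> are exchanged for those of the curve one after the other, and the increments are added.\<close>

lemma chain_rule_partial_derivatives:
  assumes W: "openin (Euclidean_space m) W" "y \<in> W"
    and df: "\<And>j x. j < m \<Longrightarrow> x \<in> W \<Longrightarrow> ((\<lambda>t. f (x(j := t))) has_real_derivative f' j x) (at (x j))"
    and cf: "\<And>j. j < m \<Longrightarrow> continuous_map (subtopology (Euclidean_space m) W) euclideanreal (f' j)"
    and c: "\<And>i. i < m \<Longrightarrow> (c i has_real_derivative d i) (at t0)" "\<And>i. i < m \<Longrightarrow> c i t0 = y i"
  shows "((\<lambda>t. f (\<lambda>i. if i < m then c i t else y i)) has_real_derivative (\<Sum>j<m. f' j y * d j)) (at t0)"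
proof -
  have "((\<lambda>t. f (\<lambda>i. if i < k then c i t else y i)) has_real_derivative (\<Sum>j<k. f' j y * d j)) (at t0)"
    if "k \<le> m" for k
    using that
  proof (induction k)
    case (Suc k)
    have "((\<lambda>t. f (\<lambda>i. if i < Suc k then c i t else y i) - f (\<lambda>i. if i < k then c i t else y i))
            has_real_derivative f' k y * d k) (at t0)"
    proof (rule chain_rule_coordinate_increment[OF W])
      show "((\<lambda>t. f (x(k := t))) has_real_derivative f' k x) (at (x k))" if "x \<in> W" for x
        by (rule df) (use Suc.prems that in auto)
      show "continuous_map (subtopology (Euclidean_space m) W) euclideanreal (f' k)"
        by (rule cf) (use Suc.prems in auto)
    qed (use Suc.prems c in auto)
    from DERIV_add[OF Suc.IH this] Suc.prems show ?case by simp
  qed simp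
  then show ?thesis by blast
qed

text \<open>Each partial derivative of the composite is a sum of products of a partial derivative of
  \<open>f\<close>, composed with \<open>F\<close>, and one of a component of \<open>F\<close>. Hence the induction on the order
  has to be carried out for all \<open>f\<close> at once.\<close>

lemma Ck_compose:
  assumes U: "openin (Euclidean_space n) U" and W: "openin (Euclidean_space m) W"
    and FW: "\<And>x. x \<in> U \<Longrightarrow> F x \<in> W"
  shows "(\<And>j. j < m \<Longrightarrow> Ck k n U (\<lambda>x. F x j)) \<Longrightarrow> Ck k m W f \<Longrightarrow> Ck k n U (\<lambda>x. f (F x))"
proof -
  let ?X = "subtopology (Euclidean_space n) U"
  have F0: "F x i = 0" if "x \<in> U" "i \<ge> m" for x i
    using openin_subset[OF W] FW[OF that(1)] that(2) by (auto simp: topspace_Euclidean_space)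
  have cont: "continuous_map ?X euclideanreal (\<lambda>x. f (F x))"
    if F: "\<And>j. j < m \<Longrightarrow> Ck k n U (\<lambda>x. F x j)" and f: "Ck k m W f" for f k
  proof -
    have "continuous_map ?X euclideanreal (\<lambda>x. F x j)" for j
    proof (cases "j < m")
      case True
      show ?thesis by (rule Ck_imp_continuous_map[OF F[OF True]])
    next
      case False
      show ?thesis
        by (rule continuous_map_eq[of ?X euclideanreal "\<lambda>x. 0"]) (use F0 False in auto)
    qed
    then have "continuous_map ?X (powertop_real UNIV) F"
      by (simp add: continuous_map_componentwise_UNIV)
    moreover have "F \<in> topspace ?X \<rightarrow> {y. \<forall>i\<ge>m. y i = 0} \<inter> W"
      using F0 FW by auto
    ultimately have "continuous_map ?X (subtopology (Euclidean_space m) W) F"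
      unfolding Euclidean_space_def[of m] subtopology_subtopology continuous_map_in_subtopology
      by blast
    from continuous_map_compose[OF this Ck_imp_continuous_map[OF f]] show ?thesis by (simp add: comp_def)
  qed
  show "(\<And>j. j < m \<Longrightarrow> Ck k n U (\<lambda>x. F x j)) \<Longrightarrow> Ck k m W f \<Longrightarrow> Ck k n U (\<lambda>x. f (F x))"
  proof (induction k arbitrary: f)
    case 0
    then show ?case using cont[where k = 0 and f = f] by simp
  next
    case (Suc k)
    show ?case
    proof (rule Ck_SucI)
      show "continuous_map ?X euclideanreal (\<lambda>x. f (F x))"
        using Suc.prems by (rule cont[where k = "Suc k" and f = f])
    next
      fix i assume i: "i < n"
      have "\<exists>f'. (\<forall>x\<in>W. ((\<lambda>t. f (x(j := t))) has_real_derivative f' x) (at (x j))) \<and> Ck k m W f'"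
        if "j < m" for j
        using Suc.prems(2) that by (rule Ck_SucD)
      then obtain f' where
        f': "\<And>j x. j < m \<Longrightarrow> x \<in> W \<Longrightarrow> ((\<lambda>t. f (x(j := t))) has_real_derivative f' j x) (at (x j))"
        "\<And>j. j < m \<Longrightarrow> Ck k m W (f' j)"
        by metis
      have "\<exists>F'. (\<forall>x\<in>U. ((\<lambda>t. F (x(i := t)) j) has_real_derivative F' x) (at (x i))) \<and> Ck k n U F'"
        if "j < m" for j
        using Suc.prems(1)[OF that] i by (rule Ck_SucD)
      then obtain F' where
        F': "\<And>j x. j < m \<Longrightarrow> x \<in> U \<Longrightarrow> ((\<lambda>t. F (x(i := t)) j) has_real_derivative F' j x) (at (x i))"
        "\<And>j. j < m \<Longrightarrow> Ck k n U (F' j)"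
        by metis
      have "((\<lambda>t. f (F (x(i := t)))) has_real_derivative (\<Sum>j<m. f' j (F x) * F' j x)) (at (x i))"
        if x: "x \<in> U" for x
      proof -
        have *: "((\<lambda>t. f (\<lambda>j. if j < m then F (x(i := t)) j else F x j))
            has_real_derivative (\<Sum>j<m. f' j (F x) * F' j x)) (at (x i))"
          by (rule chain_rule_partial_derivatives[OF W FW[OF x]])
            (use f' F' x in \<open>auto intro: Ck_imp_continuous_map simp del: fun_upd_apply\<close>)
        have ev: "\<forall>\<^sub>F t in nhds (x i).
            f (\<lambda>j. if j < m then F (x(i := t)) j else F x j) = f (F (x(i := t)))"
          using eventually_coordinate_line_in_open[OF U x i]
        proof eventually_elim
          case (elim t)
          then have "(\<lambda>j. if j < m then F (x(i := t)) j else F x j) = F (x(i := t))"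
            using F0 x by (intro ext) simp
          then show ?case by simp
        qed
        from * DERIV_cong_ev[OF refl ev refl] show ?thesis by blast
      qed
      moreover have "Ck k n U (\<lambda>x. \<Sum>j<m. f' j (F x) * F' j x)"
      proof (rule Ck_sum)
        fix j assume "j \<in> {..<m}"
        then have j: "j < m" by simp
        have "Ck k n U (\<lambda>x. f' j (F x))"
          by (rule Suc.IH[OF Ck_Suc_imp_Ck[OF Suc.prems(1)] f'(2)[OF j]])
        then show "Ck k n U (\<lambda>x. f' j (F x) * F' j x)"
          using F'(2)[OF j] by (rule Ck_mult)
      qed
      ultimately show "\<exists>f'. (\<forall>x\<in>U. ((\<lambda>t. f (F (x(i := t)))) has_real_derivative f' x) (at (x i)))
          \<and> Ck k n U f'"
        by (intro exI[of _ "\<lambda>x. \<Sum>j<m. f' j (F x) * F' j x"]) simp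
    qed
  qed
qed


section \<open>Smooth functions on a manifold\<close>

lemma chart_properties:
  assumes "smooth_manifold M" "(U, \<phi>) \<in> mfd_atlas M"
  shows chart_open: "openin (mfd_top M) U"
    and chart_subset: "U \<subseteq> pts M"
    and chart_image_open: "openin (Euclidean_space (mfd_dim M)) (\<phi> ` U)"
    and chart_inj: "inj_on \<phi> U"
    and chart_open_map: "\<And>V. openin (mfd_top M) V \<Longrightarrow> V \<subseteq> U \<Longrightarrow>
           openin (Euclidean_space (mfd_dim M)) (\<phi> ` V)"
proof -
  let ?E = "Euclidean_space (mfd_dim M)"
  have c: "openin (mfd_top M) U" "openin ?E (\<phi> ` U)"
    "homeomorphic_map (subtopology (mfd_top M) U) (subtopology ?E (\<phi> ` U)) \<phi>"
    using assms unfolding smooth_manifold_def is_chart_def by auto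
  show "openin (mfd_top M) U" "openin ?E (\<phi> ` U)" by fact+
  show sub: "U \<subseteq> pts M" using openin_subset[OF c(1)] .
  show "inj_on \<phi> U"
    using homeomorphic_imp_injective_map[OF c(3)] sub by (simp add: Int_absorb1)
  fix V assume V: "openin (mfd_top M) V" "V \<subseteq> U"
  then have "openin (subtopology (mfd_top M) U) V"
    using c(1) by (simp add: openin_open_subtopology)
  then have "openin (subtopology ?E (\<phi> ` U)) (\<phi> ` V)"
    using homeomorphic_imp_open_map[OF c(3)] unfolding open_map_def by blast
  then show "openin ?E (\<phi> ` V)"
    by (simp add: openin_open_subtopology[OF c(2)])
qed

lemma smooth_functionsI:
  assumes "\<And>U \<phi> k. (U, \<phi>) \<in> mfd_atlas M \<Longrightarrow> Ck k (mfd_dim M) (\<phi> ` U) (\<lambda>x. f (inv_into U \<phi> x))"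
  shows "f \<in> smooth_functions M"
  using assms unfolding smooth_functions_def Cinf_def by (auto simp: comp_def)

lemma smooth_functionsD:
  assumes "f \<in> smooth_functions M" "(U, \<phi>) \<in> mfd_atlas M"
  shows "Ck k (mfd_dim M) (\<phi> ` U) (\<lambda>x. f (inv_into U \<phi> x))"
  using assms unfolding smooth_functions_def Cinf_def by (auto simp: comp_def)

lemma smooth_functions_cong:
  assumes "smooth_manifold M" "f \<in> smooth_functions M" "\<And>p. p \<in> pts M \<Longrightarrow> f p = h p"
  shows "h \<in> smooth_functions M"
proof (rule smooth_functionsI)
  fix U \<phi> k assume c: "(U, \<phi>) \<in> mfd_atlas M"
  show "Ck k (mfd_dim M) (\<phi> ` U) (\<lambda>x. h (inv_into U \<phi> x))"
  proof (rule Ck_cong[where f = "\<lambda>x. f (inv_into U \<phi> x)"])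
    show "openin (Euclidean_space (mfd_dim M)) (\<phi> ` U)"
      by (rule chart_image_open[OF assms(1) c])
    show "Ck k (mfd_dim M) (\<phi> ` U) (\<lambda>x. f (inv_into U \<phi> x))"
      by (rule smooth_functionsD[OF assms(2) c])
    fix x assume "x \<in> \<phi> ` U"
    then have "inv_into U \<phi> x \<in> pts M"
      using inv_into_into[of x \<phi> U] chart_subset[OF assms(1) c] by blast
    then show "f (inv_into U \<phi> x) = h (inv_into U \<phi> x)" by (rule assms(3))
  qed
qed

lemma smooth_functions_const: "(\<lambda>p. c) \<in> smooth_functions M"
  by (rule smooth_functionsI) (rule Ck_const)

lemma smooth_functions_add:
  "f \<in> smooth_functions M \<Longrightarrow> h \<in> smooth_functions M \<Longrightarrow> f + h \<in> smooth_functions M"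
  by (rule smooth_functionsI) (simp add: plus_fun_def Ck_add smooth_functionsD)

lemma smooth_functions_mult:
  "f \<in> smooth_functions M \<Longrightarrow> h \<in> smooth_functions M \<Longrightarrow> f * h \<in> smooth_functions M"
  by (rule smooth_functionsI) (simp add: times_fun_def Ck_mult smooth_functionsD)

lemma smooth_functions_scale:
  "f \<in> smooth_functions M \<Longrightarrow> (\<lambda>p. c * f p) \<in> smooth_functions M"
  using smooth_functions_mult[OF smooth_functions_const] by (simp add: times_fun_def)

text \<open>Near a point sent into a chart \<open>(V, \<psi>)\<close> of \<open>N\<close>, the coordinate expression of \<open>f \<circ> g\<close>
  factors through \<open>\<psi>\<close> into that of \<open>f\<close> and that of \<open>g\<close>. The factorisation depends on \<open>V\<close>,
  and the pieces are glued by \<open>Ck_locally\<close>.\<close>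

lemma smooth_map_pullback:
  assumes M: "smooth_manifold M" and N: "smooth_manifold N"
    and g: "smooth_map M N g" and f: "f \<in> smooth_functions N"
  shows "f \<circ> g \<in> smooth_functions M"
proof (rule smooth_functionsI)
  fix U \<phi> k assume c: "(U, \<phi>) \<in> mfd_atlas M"
  have cont: "continuous_map (mfd_top M) (mfd_top N) g"
    using g unfolding smooth_map_def by blast
  show "Ck k (mfd_dim M) (\<phi> ` U) (\<lambda>x. (f \<circ> g) (inv_into U \<phi> x))"
  proof (rule Ck_locally)
    fix x assume x: "x \<in> \<phi> ` U"
    let ?p = "inv_into U \<phi> x"
    have p: "?p \<in> U" "\<phi> ?p = x" using x by (auto intro: inv_into_into f_inv_into_f)
    have "(\<Union>(V, \<psi>)\<in>mfd_atlas N. V) = pts N"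
      using N by (simp add: smooth_manifold_def)
    moreover have "g ?p \<in> pts N"
      using p(1) chart_subset[OF M c] continuous_map_image_subset_topspace[OF cont] by blast
    ultimately obtain V \<psi> where d: "(V, \<psi>) \<in> mfd_atlas N" "g ?p \<in> V"
      by blast
    let ?W = "U \<inter> g -` V"
    have "openin (mfd_top M) {q \<in> pts M. g q \<in> V}"
      by (rule openin_continuous_map_preimage[OF cont chart_open[OF N d(1)]])
    then have "openin (mfd_top M) (U \<inter> {q \<in> pts M. g q \<in> V})"
      by (rule openin_Int[OF chart_open[OF M c]])
    moreover have "U \<inter> {q \<in> pts M. g q \<in> V} = ?W" using chart_subset[OF M c] by auto
    ultimately have op: "openin (Euclidean_space (mfd_dim M)) (\<phi> ` ?W)"
      by (intro chart_open_map[OF M c]) auto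
    have inW: "inv_into U \<phi> y \<in> ?W" if "y \<in> \<phi> ` ?W" for y
      using that chart_inj[OF M c] by (auto simp: inv_into_f_f)
    have "Cinf_map (mfd_dim M) (mfd_dim N) (\<phi> ` ?W) (\<psi> \<circ> g \<circ> inv_into U \<phi>)"
      using g c d(1) unfolding smooth_map_def by blast
    then have F: "Ck k (mfd_dim M) (\<phi> ` ?W) (\<lambda>y. \<psi> (g (inv_into U \<phi> y)) i)" if "i < mfd_dim N" for i
      using that by (simp add: Cinf_map_def Cinf_def)
    have "Ck k (mfd_dim M) (\<phi> ` ?W) (\<lambda>y. f (inv_into V \<psi> (\<psi> (g (inv_into U \<phi> y)))))"
    proof (rule Ck_compose[OF op chart_image_open[OF N d(1)],
          where F = "\<lambda>y. \<psi> (g (inv_into U \<phi> y))" and f = "\<lambda>z. f (inv_into V \<psi> z)"])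
      show "\<psi> (g (inv_into U \<phi> y)) \<in> \<psi> ` V" if "y \<in> \<phi> ` ?W" for y
        using inW[OF that] by blast
      show "Ck k (mfd_dim N) (\<psi> ` V) (\<lambda>z. f (inv_into V \<psi> z))"
        by (rule smooth_functionsD[OF f d(1)])
    qed (rule F)
    then have "Ck k (mfd_dim M) (\<phi> ` ?W) (\<lambda>y. (f \<circ> g) (inv_into U \<phi> y))"
    proof (rule Ck_cong[where f = "\<lambda>y. f (inv_into V \<psi> (\<psi> (g (inv_into U \<phi> y))))", OF op, rotated])
      fix y assume "y \<in> \<phi> ` ?W"
      from inW[OF this] show "f (inv_into V \<psi> (\<psi> (g (inv_into U \<phi> y)))) = (f \<circ> g) (inv_into U \<phi> y)"
        using chart_inj[OF N d(1)] by simp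
    qed
    moreover have "x \<in> \<phi> ` ?W" using p d(2) by (intro image_eqI[of _ _ ?p]) auto
    ultimately show "\<exists>V. openin (Euclidean_space (mfd_dim M)) V \<and> x \<in> V \<and> V \<subseteq> \<phi> ` U \<and>
        Ck k (mfd_dim M) V (\<lambda>x. (f \<circ> g) (inv_into U \<phi> x))"
      using op by (intro exI[of _ "\<phi> ` ?W"]) auto
  qed
qed


section \<open>Differentials and the action on vector fields\<close>

text \<open>The difference \<open>d\<close> of two functions that agree on the manifold satisfies \<open>d = d * e\<close>,
  where \<open>e\<close> is the indicator of the complement of the manifold. Both factors are smooth and
  vanish at \<open>p\<close>, so the Leibniz rule kills \<open>d\<close>.\<close>

lemma tangent_vector_cong:
  assumes M: "smooth_manifold M" and v: "v \<in> tangent_space M p" and p: "p \<in> pts M"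
    and fh: "\<And>q. q \<in> pts M \<Longrightarrow> f q = h q"
  shows "v f = v h"
proof (cases "f \<in> smooth_functions M")
  case True
  have h: "h \<in> smooth_functions M"
    using smooth_functions_cong[OF M True fh] .
  define e where "e = (\<lambda>q. if q \<in> pts M then 0 else 1 :: real)"
  define d where "d = f + (\<lambda>q. - 1 * h q)"
  have e: "e \<in> smooth_functions M"
    by (rule smooth_functions_cong[OF M smooth_functions_const[of 0]]) (simp add: e_def)
  have nh: "(\<lambda>q. - 1 * h q) \<in> smooth_functions M"
    by (rule smooth_functions_scale[OF h])
  have d: "d \<in> smooth_functions M"
    unfolding d_def by (rule smooth_functions_add[OF True nh])
  have "d = d * e"
    using fh by (auto simp: d_def e_def fun_eq_iff)
  moreover have "v (d * e) = d p * v e + e p * v d"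
    using v d e unfolding tangent_space_def by blast
  moreover have "d p = 0" "e p = 0"
    using p fh by (auto simp: d_def e_def)
  ultimately have "v d = 0" by simp
  moreover have "v d = v f + v (\<lambda>q. - 1 * h q)"
    using v True nh unfolding d_def tangent_space_def by blast
  moreover have "v (\<lambda>q. - 1 * h q) = - 1 * v h"
    using v h unfolding tangent_space_def by blast
  ultimately show ?thesis by simp
next
  case False
  then have "h \<notin> smooth_functions M"
    using smooth_functions_cong[OF M, of h f] fh by metis
  with False v show ?thesis unfolding tangent_space_def by simp
qed

text \<open>What is needed of a diffeomorphism to act on derivations. Unlike \<open>diffeo\<close>, which refers to
  charts, this form passes to the inverse map by replacing functions by others that agree on
  the manifold.\<close>

definition smooth_symmetry :: "'a manifold \<Rightarrow> ('a \<Rightarrow> 'a) \<Rightarrow> bool" where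
  "smooth_symmetry M g \<longleftrightarrow> bij_betw g (pts M) (pts M) \<and>
     (\<forall>f\<in>smooth_functions M. f \<circ> g \<in> smooth_functions M \<and> f \<circ> mfd_inv M g \<in> smooth_functions M)"

lemma diffeo_imp_smooth_symmetry:
  assumes "smooth_manifold M" "diffeo M g"
  shows "smooth_symmetry M g"
  using assms unfolding smooth_symmetry_def diffeo_def by (simp add: smooth_map_pullback)

lemma smooth_symmetry_bij:
  assumes "smooth_symmetry M g" "p \<in> pts M"
  shows "g p \<in> pts M" "mfd_inv M g p \<in> pts M" "g (mfd_inv M g p) = p" "mfd_inv M g (g p) = p"
    "mfd_inv M (mfd_inv M g) p = g p"
proof -
  have b: "bij_betw g (pts M) (pts M)" using assms(1) unfolding smooth_symmetry_def by blast
  show "g p \<in> pts M" using bij_betwE[OF b] assms(2) by blast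
  show "mfd_inv M g p \<in> pts M" using bij_betwE[OF bij_betw_inv_into[OF b]] assms(2) by blast
  show "g (mfd_inv M g p) = p" using bij_betw_inv_into_right[OF b assms(2)] .
  show "mfd_inv M g (g p) = p" using bij_betw_inv_into_left[OF b assms(2)] .
  show "mfd_inv M (mfd_inv M g) p = g p" using inv_into_inv_into_eq[OF b assms(2)] .
qed

lemma smooth_symmetry_inverse:
  assumes "smooth_manifold M" "smooth_symmetry M g"
  shows "smooth_symmetry M (mfd_inv M g)"
proof -
  have "f \<circ> mfd_inv M (mfd_inv M g) \<in> smooth_functions M" if "f \<in> smooth_functions M" for f
    by (rule smooth_functions_cong[OF assms(1), of "f \<circ> g"])
      (use that assms(2) smooth_symmetry_bij(5)[OF assms(2)] in \<open>auto simp: smooth_symmetry_def\<close>)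
  with assms(2) show ?thesis
    unfolding smooth_symmetry_def by (simp add: bij_betw_inv_into)
qed

lemma differential_add: "differential M g (v + w) = differential M g v + differential M g w"
  and differential_diff: "differential M g (v - w) = differential M g v - differential M g w"
  and differential_minus: "differential M g (- v) = - differential M g v"
  and differential_tscale: "differential M g (tscale c v) = tscale c (differential M g v)"
  by (auto simp: differential_def tscale_def fun_eq_iff)

lemma differential_tangent:
  assumes "smooth_symmetry M g" "v \<in> tangent_space M p"
  shows "differential M g v \<in> tangent_space M (g p)"
proof -
  note S = smooth_functions_add smooth_functions_mult smooth_functions_scale
  have g: "f \<circ> g \<in> smooth_functions M" if "f \<in> smooth_functions M" for f
    using assms(1) that unfolding smooth_symmetry_def by blast
  have v: "\<And>f h. f \<in> smooth_functions M \<Longrightarrow> h \<in> smooth_functions M \<Longrightarrow> v (f + h) = v f + v h"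
    "\<And>c f. f \<in> smooth_functions M \<Longrightarrow> v (\<lambda>x. c * f x) = c * v f"
    "\<And>f h. f \<in> smooth_functions M \<Longrightarrow> h \<in> smooth_functions M \<Longrightarrow> v (f * h) = f p * v h + h p * v f"
    using assms(2) unfolding tangent_space_def by blast+
  have comp: "(f + h) \<circ> g = (f \<circ> g) + (h \<circ> g)" "(f * h) \<circ> g = (f \<circ> g) * (h \<circ> g)"
    "(\<lambda>x. c * f x) \<circ> g = (\<lambda>x. c * (f \<circ> g) x)" for f h :: "'a \<Rightarrow> real" and c
    by (auto simp: fun_eq_iff)
  show ?thesis
    unfolding tangent_space_def differential_def
    by (simp add: S comp v g del: comp_apply) simp
qed

text \<open>Both composites of the differentials evaluate \<open>v\<close> at a function that agrees with the given
  one on the manifold only, which \<open>tangent_vector_cong\<close> shows to be enough.\<close>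

lemma differential_inverse:
  assumes M: "smooth_manifold M" and g: "smooth_symmetry M g"
    and v: "v \<in> tangent_space M p" and p: "p \<in> pts M"
  shows "differential M (mfd_inv M g) (differential M g v) = v"
    and "differential M g (differential M (mfd_inv M g) v) = v"
proof -
  have *: "differential M a (differential M b v) = v"
    if "\<And>f. f \<in> smooth_functions M \<Longrightarrow> f \<circ> a \<in> smooth_functions M" "\<And>q. q \<in> pts M \<Longrightarrow> a (b q) = q"
    for a b
  proof
    fix f
    show "differential M a (differential M b v) f = v f"
    proof (cases "f \<in> smooth_functions M")
      case True
      then have "differential M a (differential M b v) f = v (f \<circ> a \<circ> b)"
        using that(1) by (simp add: differential_def)
      also have "\<dots> = v f"
        by (rule tangent_vector_cong[OF M v p]) (simp add: that(2))
      finally show ?thesis .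
    next
      case False
      then show ?thesis using v by (simp add: differential_def tangent_space_def)
    qed
  qed
  show "differential M (mfd_inv M g) (differential M g v) = v"
    "differential M g (differential M (mfd_inv M g) v) = v"
    by (rule *; use g smooth_symmetry_bij[OF g] in \<open>simp add: smooth_symmetry_def\<close>)+
qed

lemma vector_fields_tangent:
  "X \<in> vector_fields M \<Longrightarrow> p \<in> pts M \<Longrightarrow> X p \<in> tangent_space M p"
  unfolding vector_fields_def by blast

lemma act_field_vector_fields:
  assumes M: "smooth_manifold M" and g: "smooth_symmetry M g" and X: "X \<in> vector_fields M"
  shows "act_field M g X \<in> vector_fields M"
proof -
  have "act_field M g X p \<in> tangent_space M p" if p: "p \<in> pts M" for p
    using differential_tangent[OF g vector_fields_tangent[OF X smooth_symmetry_bij(2)[OF g p]]] p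
      smooth_symmetry_bij(3)[OF g p] by (simp add: act_field_def)
  moreover have "(\<lambda>p. act_field M g X p f) \<in> smooth_functions M" if f: "f \<in> smooth_functions M" for f
  proof -
    have "(\<lambda>p. X p (f \<circ> g)) \<in> smooth_functions M"
      using X f g unfolding vector_fields_def smooth_symmetry_def by blast
    then have "(\<lambda>p. X p (f \<circ> g)) \<circ> mfd_inv M g \<in> smooth_functions M"
      using g unfolding smooth_symmetry_def by blast
    then show ?thesis
      by (rule smooth_functions_cong[OF M]) (simp add: act_field_def differential_def f)
  qed
  ultimately show ?thesis
    unfolding vector_fields_def by (simp add: act_field_def)
qed

text \<open>The definition of the action of \<open>g\<inverse>\<close> evaluates the field at the inverse of \<open>g\<inverse>\<close>, a choice
  function that coincides with \<open>g\<close> on the manifold.\<close>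

lemma act_field_inverse_apply:
  assumes "smooth_symmetry M g" "p \<in> pts M"
  shows "act_field M (mfd_inv M g) X p = differential M (mfd_inv M g) (X (g p))"
  using assms by (simp add: act_field_def smooth_symmetry_bij(5))

lemma act_field_add:
  "act_field M g (\<lambda>p. X p + Y p) = (\<lambda>p. act_field M g X p + act_field M g Y p)"
  and act_field_diff:
  "act_field M g (\<lambda>p. X p - Y p) = (\<lambda>p. act_field M g X p - act_field M g Y p)"
  by (auto simp: act_field_def differential_add differential_diff)


section \<open>Transport of almost complex structures\<close>

lemma conj_endo_differential:
  assumes "smooth_manifold M" "smooth_symmetry M g" "p \<in> pts M" "v \<in> tangent_space M (mfd_inv M g p)"
  shows "conj_endo M g j p (differential M g v) = differential M g (j (mfd_inv M g p) v)"
  using differential_inverse(1)[OF assms(1,2,4)] smooth_symmetry_bij(2)[OF assms(2,3)]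
  by (simp add: conj_endo_def)

text \<open>All pointwise axioms are transported by the linear isomorphism \<open>dg\<close>. Smoothness holds
  because applying the conjugate to \<open>X\<close> amounts to pushing \<open>j (g\<inverse>\<cdot>X)\<close> forward by \<open>g\<close>.\<close>

lemma almost_complex_structure_conj_endo:
  assumes M: "smooth_manifold M" and g: "smooth_symmetry M g" and j: "almost_complex_structure M j"
  shows "almost_complex_structure M (conj_endo M g j)"
  unfolding almost_complex_structure_def
proof (intro conjI ballI allI)
  let ?g' = "mfd_inv M g"
  fix p assume p: "p \<in> pts M"
  let ?q = "?g' p"
  have q: "?q \<in> pts M" "g ?q = p" using smooth_symmetry_bij[OF g p] by auto
  have pull: "differential M ?g' v \<in> tangent_space M ?q" if "v \<in> tangent_space M p" for v
    using differential_tangent[OF smooth_symmetry_inverse[OF M g] that] .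
  have jq: "\<And>v. v \<in> tangent_space M ?q \<Longrightarrow> j ?q v \<in> tangent_space M ?q"
    "\<And>v w. v \<in> tangent_space M ?q \<Longrightarrow> w \<in> tangent_space M ?q \<Longrightarrow> j ?q (v + w) = j ?q v + j ?q w"
    "\<And>c v. v \<in> tangent_space M ?q \<Longrightarrow> j ?q (tscale c v) = tscale c (j ?q v)"
    "\<And>v. v \<in> tangent_space M ?q \<Longrightarrow> j ?q (j ?q v) = - v"
    using j q(1) unfolding almost_complex_structure_def by blast+
  fix v assume v: "v \<in> tangent_space M p"
  show "conj_endo M g j p v \<in> tangent_space M p"
    using differential_tangent[OF g jq(1)[OF pull[OF v]]] q(2) by (simp add: conj_endo_def)
  show "conj_endo M g j p (v + w) = conj_endo M g j p v + conj_endo M g j p w"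
    if "w \<in> tangent_space M p" for w
    using pull[OF v] pull[OF that] by (simp add: conj_endo_def differential_add jq(2))
  show "conj_endo M g j p (tscale c v) = tscale c (conj_endo M g j p v)" for c
    using pull[OF v] by (simp add: conj_endo_def differential_tscale jq(3))
  have "conj_endo M g j p (conj_endo M g j p v) = differential M g (j ?q (j ?q (differential M ?g' v)))"
    using conj_endo_differential[OF M g p jq(1)[OF pull[OF v]]] by (simp add: conj_endo_def)
  also have "\<dots> = - v"
    by (simp add: jq(4)[OF pull[OF v]] differential_minus differential_inverse(2)[OF M g v p])
  finally show "conj_endo M g j p (conj_endo M g j p v) = - v" .
next
  let ?g' = "mfd_inv M g"
  fix X assume X: "X \<in> vector_fields M"
  define Y where "Y = act_field M ?g' X"
  have "Y \<in> vector_fields M"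
    unfolding Y_def by (rule act_field_vector_fields[OF M smooth_symmetry_inverse[OF M g] X])
  then have "(\<lambda>p. if p \<in> pts M then j p (Y p) else 0) \<in> vector_fields M"
    using j unfolding almost_complex_structure_def by blast
  then have "act_field M g (\<lambda>p. if p \<in> pts M then j p (Y p) else 0) \<in> vector_fields M"
    by (rule act_field_vector_fields[OF M g])
  moreover have "act_field M g (\<lambda>p. if p \<in> pts M then j p (Y p) else 0) =
      (\<lambda>p. if p \<in> pts M then conj_endo M g j p (X p) else 0)"
    using smooth_symmetry_bij[OF g]
    by (auto simp: act_field_def[of M g] Y_def act_field_inverse_apply[OF g] conj_endo_def fun_eq_iff)
  ultimately show "(\<lambda>p. if p \<in> pts M then conj_endo M g j p (X p) else 0) \<in> vector_fields M"
    by simp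
qed

definition act_complex_field ::
  "'a manifold \<Rightarrow> ('a \<Rightarrow> 'a) \<Rightarrow> ('a \<Rightarrow> 'a ctvec) \<Rightarrow> 'a \<Rightarrow> 'a ctvec" where
  "act_complex_field M g Z = (\<lambda>p. (act_field M g (re_part Z) p, act_field M g (im_part Z) p))"

lemma re_part_act_complex_field [simp]: "re_part (act_complex_field M g Z) = act_field M g (re_part Z)"
  and im_part_act_complex_field [simp]: "im_part (act_complex_field M g Z) = act_field M g (im_part Z)"
  by (simp_all add: act_complex_field_def re_part_def im_part_def)

text \<open>For \<open>Z = u + i v\<close> the eigenvalue equation \<open>j Z = i Z\<close> reads \<open>j u = - v\<close> and \<open>j v = u\<close>.\<close>

lemma fields_10_iff:
  "Z \<in> fields_10 M j \<longleftrightarrow> re_part Z \<in> vector_fields M \<and> im_part Z \<in> vector_fields M \<and>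
     (\<forall>p\<in>pts M. j p (re_part Z p) = - im_part Z p \<and> j p (im_part Z p) = re_part Z p)"
  by (auto simp: fields_10_def complex_vector_fields_def complexify_def mult_i_def re_part_def
      im_part_def split: prod.splits)

text \<open>By \<open>conj_endo_differential\<close>, \<open>dg\<close> intertwines \<open>j\<close> with its conjugate, so it maps the
  \<open>+i\<close>-eigenspaces of the former into those of the latter.\<close>

lemma act_complex_field_fields_10:
  assumes M: "smooth_manifold M" and g: "smooth_symmetry M g" and Z: "Z \<in> fields_10 M j"
  shows "act_complex_field M g Z \<in> fields_10 M (conj_endo M g j)"
proof -
  have R: "re_part Z \<in> vector_fields M" and I: "im_part Z \<in> vector_fields M"
    using Z by (auto simp: fields_10_iff)
  have "conj_endo M g j p (act_field M g (re_part Z) p) = - act_field M g (im_part Z) p \<and>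
      conj_endo M g j p (act_field M g (im_part Z) p) = act_field M g (re_part Z) p"
    if p: "p \<in> pts M" for p
  proof -
    have q: "mfd_inv M g p \<in> pts M" using smooth_symmetry_bij(2)[OF g p] .
    then have "j (mfd_inv M g p) (re_part Z (mfd_inv M g p)) = - im_part Z (mfd_inv M g p)"
      "j (mfd_inv M g p) (im_part Z (mfd_inv M g p)) = re_part Z (mfd_inv M g p)"
      using Z by (auto simp: fields_10_iff)
    then show ?thesis
      using p by (simp add: act_field_def differential_minus
          conj_endo_differential[OF M g p vector_fields_tangent[OF R q]]
          conj_endo_differential[OF M g p vector_fields_tangent[OF I q]])
  qed
  then show ?thesis
    by (simp add: fields_10_iff act_field_vector_fields[OF M g] R I)
qed

text \<open>The converse direction uses \<open>j (dg\<inverse> v) = dg\<inverse> ((dg j dg\<inverse>) v)\<close>; cancelling \<open>dg\<inverse> dg\<close>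
  there requires that \<open>j\<close> preserves tangent spaces.\<close>

lemma act_complex_field_inverse_fields_10:
  assumes M: "smooth_manifold M" and g: "smooth_symmetry M g" and j: "almost_complex_structure M j"
    and Z: "Z \<in> fields_10 M (conj_endo M g j)"
  shows "act_complex_field M (mfd_inv M g) Z \<in> fields_10 M j"
proof -
  let ?g' = "mfd_inv M g"
  note g' = smooth_symmetry_inverse[OF M g]
  have R: "re_part Z \<in> vector_fields M" and I: "im_part Z \<in> vector_fields M"
    using Z by (auto simp: fields_10_iff)
  have key: "j q (differential M ?g' v) = differential M ?g' (conj_endo M g j (g q) v)"
    if q: "q \<in> pts M" and v: "v \<in> tangent_space M (g q)" for q v
  proof -
    have "differential M ?g' v \<in> tangent_space M q"
      using differential_tangent[OF g' v] smooth_symmetry_bij(4)[OF g q] by simp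
    then have "j q (differential M ?g' v) \<in> tangent_space M q"
      using j q unfolding almost_complex_structure_def by blast
    from differential_inverse(1)[OF M g this q] show ?thesis
      by (simp add: conj_endo_def smooth_symmetry_bij(4)[OF g q])
  qed
  have "j q (act_field M ?g' (re_part Z) q) = - act_field M ?g' (im_part Z) q \<and>
      j q (act_field M ?g' (im_part Z) q) = act_field M ?g' (re_part Z) q"
    if q: "q \<in> pts M" for q
  proof -
    have p: "g q \<in> pts M" using smooth_symmetry_bij(1)[OF g q] .
    then have "conj_endo M g j (g q) (re_part Z (g q)) = - im_part Z (g q)"
      "conj_endo M g j (g q) (im_part Z (g q)) = re_part Z (g q)"
      using Z by (auto simp: fields_10_iff)
    then show ?thesis
      by (simp add: act_field_inverse_apply[OF g q] differential_minus
          key[OF q vector_fields_tangent[OF R p]] key[OF q vector_fields_tangent[OF I p]])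
  qed
  then show ?thesis
    by (simp add: fields_10_iff act_field_vector_fields[OF M g'] R I)
qed

text \<open>The complex extension is built from real components by sums and differences, with which
  the action of \<open>g\<close> commutes, so invariance for real fields carries over.\<close>

lemma complex_connection_invariant:
  assumes inv: "\<And>X Y. X \<in> vector_fields M \<Longrightarrow> Y \<in> vector_fields M \<Longrightarrow> act_connection M g nabla X Y = nabla X Y"
    and Z: "Z \<in> complex_vector_fields M" and W: "W \<in> complex_vector_fields M"
  shows "act_complex_field M g (complex_connection nabla
           (act_complex_field M (mfd_inv M g) Z) (act_complex_field M (mfd_inv M g) W)) =
         complex_connection nabla Z W"
proof -
  let ?act = "act_field M (mfd_inv M g)"
  have part: "act_field M g (nabla (?act X) (?act Y)) = nabla X Y"
    if "X \<in> vector_fields M" "Y \<in> vector_fields M" for X Y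
    using inv[OF that] unfolding act_connection_def .
  have re: "re_part (complex_connection nabla A B) =
      (\<lambda>p. nabla (re_part A) (re_part B) p - nabla (im_part A) (im_part B) p)"
    and im: "im_part (complex_connection nabla A B) =
      (\<lambda>p. nabla (re_part A) (im_part B) p + nabla (im_part A) (re_part B) p)" for A B
    by (simp_all add: complex_connection_def re_part_def im_part_def)
  show ?thesis
    using Z W unfolding complex_vector_fields_def
    by (simp add: act_complex_field_def[of M g] re im act_field_add act_field_diff part)
      (simp add: complex_connection_def)
qed


theorem proposition2:
  fixes M :: "'a manifold"
    and nabla :: "'a connection"
    and j :: "'a \<Rightarrow> 'a tvec \<Rightarrow> 'a tvec"
    and g :: "'a \<Rightarrow> 'a"
  assumes "smooth_manifold M"
    and "even (mfd_dim M)"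
    and "linear_connection M nabla"
    and "self_holomorphic M nabla j"
    and "diffeo M g"
    and "\<forall>X\<in>vector_fields M. \<forall>Y\<in>vector_fields M. act_connection M g nabla X Y = nabla X Y"
  shows "self_holomorphic M nabla (conj_endo M g j)"
proof -
  have g: "smooth_symmetry M g"
    using diffeo_imp_smooth_symmetry[OF assms(1,5)] .
  have j: "almost_complex_structure M j"
    using assms(4) unfolding self_holomorphic_def by blast
  have "complex_connection nabla Z W \<in> fields_10 M (conj_endo M g j)"
    if Z: "Z \<in> fields_10 M (conj_endo M g j)" and W: "W \<in> fields_10 M (conj_endo M g j)" for Z W
  proof -
    let ?pull = "act_complex_field M (mfd_inv M g)"
    have "complex_connection nabla (?pull Z) (?pull W) \<in> fields_10 M j"
      using assms(4) act_complex_field_inverse_fields_10[OF assms(1) g j] Z W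
      unfolding self_holomorphic_def by blast
    then have "act_complex_field M g (complex_connection nabla (?pull Z) (?pull W))
        \<in> fields_10 M (conj_endo M g j)"
      by (rule act_complex_field_fields_10[OF assms(1) g])
    moreover have "act_complex_field M g (complex_connection nabla (?pull Z) (?pull W)) =
        complex_connection nabla Z W"
      by (rule complex_connection_invariant) (use assms(6) Z W in \<open>auto simp: fields_10_def\<close>)
    ultimately show ?thesis by simp
  qed
  then show ?thesis
    unfolding self_holomorphic_def
    using almost_complex_structure_conj_endo[OF assms(1) g j] by blast
qed

end
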